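(* Let $X(x):\mathbb{R}^m\to T_xM$, $x\in M$, be linear, surjective and $C^\infty$ in $x$, let $e_1,\dots,e_m$ be an orthonormal basis of $\mathbb{R}^m$, $X^i=X(\cdot)e_i$, and let $\breve\nabla$ be the LeJan-Watanabe connection of $X$, with curvature tensor $\breve R$. If $x_0\in M$ and $u,v,w\in T_{x_0}M$ then $$\breve R(u,v)(w)=\sum_{i=1}^m\breve\nabla_uX^i\,\langle\breve\nabla_vX^i,w\rangle-\sum_{i=1}^m\breve\nabla_vX^i\,\langle\breve\nabla_uX^i,w\rangle .$$
   Context: $M$ is a $C^\infty$ manifold. $M$ carries the induced Riemannian metric $\langle\cdot,\cdot\rangle$, for which $X(x)$ restricted to $[\ker X(x)]^\perp$ is an isometry onto $T_xM$; $Y(x):T_xM\to\mathbb{R}^m$ is the adjoint of $X(x)$. The LeJan-Watanabe connection is $\breve\nabla_vZ=X(x)(d[Y(\cdot)Z(\cdot)](v))$, $v\in T_xM$, where $d$ is the ordinary differential of the $\mathbb{R}^m$-valued map $x\mapsto Y(x)Z(x)$. The curvature is $\breve R(U,V)W=\breve\nabla_U\breve\nabla_VW-\breve\nabla_V\breve\nabla_UW-\breve\nabla_{[U,V]}W$. *)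

theory Defs
  imports "HOL-Analysis.Analysis"
begin

text \<open>For a finite-dimensional domain, being of class \<open>C^(k+1)\<close> is the same as being differentiable
  with all directional derivatives of class \<open>C^k\<close>.\<close>

fun Ck_on :: "nat \<Rightarrow> 'e::euclidean_space set \<Rightarrow> ('e \<Rightarrow> 'f::real_normed_vector) \<Rightarrow> bool" where
  "Ck_on 0 S f \<longleftrightarrow> continuous_on S f"
| "Ck_on (Suc k) S f \<longleftrightarrow>
     (\<forall>p\<in>S. f differentiable (at p)) \<and> (\<forall>h. Ck_on k S (\<lambda>p. frechet_derivative f (at p) h))"

definition smooth_on :: "'e::euclidean_space set \<Rightarrow> ('e \<Rightarrow> 'f::real_normed_vector) \<Rightarrow> bool" where
  "smooth_on S f \<longleftrightarrow> (\<forall>k. Ck_on k S f)"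

type_synonym ('a, 'e) chart = "'a set \<times> ('a \<Rightarrow> 'e)"

abbreviation cdom :: "('a, 'e) chart \<Rightarrow> 'a set" where "cdom \<equiv> fst"
abbreviation cmap :: "('a, 'e) chart \<Rightarrow> 'a \<Rightarrow> 'e" where "cmap \<equiv> snd"
abbreviation cinv :: "('a, 'e) chart \<Rightarrow> 'e \<Rightarrow> 'a" where "cinv c \<equiv> inv_into (cdom c) (cmap c)"

definition is_chart :: "'a topology \<Rightarrow> ('a, 'e::euclidean_space) chart \<Rightarrow> bool" where
  "is_chart T c \<longleftrightarrow> openin T (cdom c) \<and> open (cmap c ` cdom c) \<and>
     homeomorphic_map (subtopology T (cdom c)) (top_of_set (cmap c ` cdom c)) (cmap c)"

text \<open>The atlas need not be maximal.\<close>

definition smooth_manifold :: "'a topology \<Rightarrow> ('a, 'e::euclidean_space) chart set \<Rightarrow> bool" where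
  "smooth_manifold T A \<longleftrightarrow>
     Hausdorff_space T \<and> second_countable T \<and>
     (\<forall>c\<in>A. is_chart T c) \<and> (\<Union>c\<in>A. cdom c) = topspace T \<and>
     (\<forall>c\<in>A. \<forall>d\<in>A. smooth_on (cmap c ` (cdom c \<inter> cdom d)) (cmap d \<circ> cinv c))"

text \<open>A tangent vector at \<open>x\<close> is a family of coordinate vectors, one for each chart around \<open>x\<close>, that
  transforms by the derivatives of the changes of coordinates. By convention the family is \<open>0\<close> at
  all charts not in the atlas or not around \<open>x\<close>. The type below of arbitrary such families
  is an ambient vector space in which every tangent space is a subspace.\<close>

typedef (overloaded) ('a, 'e) tvec = "UNIV :: (('a, 'e::real_vector) chart \<Rightarrow> 'e) set"
  morphisms tcoord Tvec
  by simp

setup_lifting type_definition_tvec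

lemma tvec_eqI: "(\<And>c. tcoord v c = tcoord w c) \<Longrightarrow> v = w"
  by (simp add: tcoord_inject[symmetric] fun_eq_iff)

instantiation tvec :: (type, real_vector) real_vector
begin

lift_definition zero_tvec :: "('a, 'b) tvec" is "\<lambda>_. 0" .
lift_definition plus_tvec :: "('a, 'b) tvec \<Rightarrow> ('a, 'b) tvec \<Rightarrow> ('a, 'b) tvec"
  is "\<lambda>v w c. v c + w c" .
lift_definition minus_tvec :: "('a, 'b) tvec \<Rightarrow> ('a, 'b) tvec \<Rightarrow> ('a, 'b) tvec"
  is "\<lambda>v w c. v c - w c" .
lift_definition uminus_tvec :: "('a, 'b) tvec \<Rightarrow> ('a, 'b) tvec"
  is "\<lambda>v c. - v c" .
lift_definition scaleR_tvec :: "real \<Rightarrow> ('a, 'b) tvec \<Rightarrow> ('a, 'b) tvec"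
  is "\<lambda>r v c. r *\<^sub>R v c" .

instance
  by standard (transfer; simp add: algebra_simps)+

end

definition charts_at :: "('a, 'e) chart set \<Rightarrow> 'a \<Rightarrow> ('a, 'e) chart set" where
  "charts_at A x = {c \<in> A. x \<in> cdom c}"

definition tangent_space ::
  "('a, 'e::real_normed_vector) chart set \<Rightarrow> 'a \<Rightarrow> ('a, 'e) tvec set" where
  "tangent_space A x = {v.
     (\<forall>c\<in>charts_at A x. \<forall>d\<in>charts_at A x.
        tcoord v d = frechet_derivative (cmap d \<circ> cinv c) (at (cmap c x)) (tcoord v c)) \<and>
     (\<forall>c. c \<notin> charts_at A x \<longrightarrow> tcoord v c = 0)}"

definition smooth_vector_field ::
  "('a, 'e::euclidean_space) chart set \<Rightarrow> 'a set \<Rightarrow> ('a \<Rightarrow> ('a, 'e) tvec) \<Rightarrow> bool" where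
  "smooth_vector_field A N Z \<longleftrightarrow>
     (\<forall>x\<in>N. Z x \<in> tangent_space A x) \<and>
     (\<forall>c\<in>A. smooth_on (cmap c ` (N \<inter> cdom c)) (\<lambda>p. tcoord (Z (cinv c p)) c))"

text \<open>The differential \<open>df(v)\<close> at \<open>x\<close> of a vector-valued function \<open>f\<close>, computed in an arbitrary chart
  around \<open>x\<close>; for \<open>v\<close> tangent at \<open>x\<close> and \<open>f\<close> differentiable at \<open>x\<close>, the chain rule makes it
  independent of the chart.\<close>

definition differential ::
  "('a, 'e::real_normed_vector) chart set \<Rightarrow> ('a \<Rightarrow> 'f::real_normed_vector) \<Rightarrow> 'a \<Rightarrow> ('a, 'e) tvec \<Rightarrow> 'f"
  where
  "differential A f x v = (let c = (SOME c. c \<in> charts_at A x)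
     in frechet_derivative (f \<circ> cinv c) (at (cmap c x)) (tcoord v c))"

text \<open>In coordinates, \<open>[U, V] = DV(U) - DU(V)\<close>.\<close>

definition lie_bracket ::
  "('a, 'e::real_normed_vector) chart set \<Rightarrow> ('a \<Rightarrow> ('a, 'e) tvec) \<Rightarrow> ('a \<Rightarrow> ('a, 'e) tvec) \<Rightarrow>
     'a \<Rightarrow> ('a, 'e) tvec" where
  "lie_bracket A U V x = Tvec (\<lambda>c. if c \<in> charts_at A x
     then frechet_derivative (\<lambda>p. tcoord (V (cinv c p)) c) (at (cmap c x)) (tcoord (U x) c)
        - frechet_derivative (\<lambda>p. tcoord (U (cinv c p)) c) (at (cmap c x)) (tcoord (V x) c)
     else 0)"

definition smooth_surjective_bundle_map ::
  "'a topology \<Rightarrow> ('a, 'e::euclidean_space) chart set \<Rightarrow>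
     ('a \<Rightarrow> 'h::euclidean_space \<Rightarrow> ('a, 'e) tvec) \<Rightarrow> bool" where
  "smooth_surjective_bundle_map T A X \<longleftrightarrow>
     (\<forall>x\<in>topspace T. linear (X x) \<and> range (X x) = tangent_space A x) \<and>
     (\<forall>a. smooth_vector_field A (topspace T) (\<lambda>x. X x a))"

definition ker_perp :: "('h::euclidean_space \<Rightarrow> 'v::real_vector) \<Rightarrow> 'h set" where
  "ker_perp L = orthogonal_comp {k. L k = 0}"

text \<open>The metric on \<open>T_x M\<close> that makes the bijection \<open>X x : ker_perp (X x) \<rightarrow> T_x M\<close> an isometry;
  see \<open>inj_on_ker_perp\<close>, \<open>image_ker_perp\<close> and \<open>induced_metric_isometry\<close>.\<close>

definition induced_metric ::
  "('a \<Rightarrow> 'h::euclidean_space \<Rightarrow> ('a, 'e::real_vector) tvec) \<Rightarrow> 'a \<Rightarrow>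
     ('a, 'e) tvec \<Rightarrow> ('a, 'e) tvec \<Rightarrow> real" where
  "induced_metric X x v w =
     inv_into (ker_perp (X x)) (X x) v \<bullet> inv_into (ker_perp (X x)) (X x) w"

lemma inj_on_ker_perp:
  assumes "linear L" shows "inj_on L (ker_perp L)"
proof (rule inj_onI)
  fix a b assume a: "a \<in> ker_perp L" and b: "b \<in> ker_perp L" and eq: "L a = L b"
  have "L (a - b) = 0" using eq by (simp add: linear_diff[OF assms])
  then have "orthogonal (a - b) a" "orthogonal (a - b) b"
    using a b by (auto simp: ker_perp_def orthogonal_comp_def)
  then show "a = b"
    by (simp add: orthogonal_def) (metis eq_iff_diff_eq_0 inner_diff_right inner_eq_zero_iff right_minus_eq)
qed

lemma image_ker_perp:
  assumes "linear L" shows "L ` ker_perp L = range L"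
proof -
  have "L z \<in> L ` ker_perp L" for z
  proof -
    obtain y k where "z = k + y" and k: "k \<in> span {k. L k = 0}"
      and y: "\<And>w. w \<in> span {k. L k = 0} \<Longrightarrow> orthogonal y w"
      by (rule orthogonal_subspace_decomp_exists) blast
    have "subspace {k. L k = 0}"
      using assms by (simp add: subspace_def linear_0 linear_add linear_scale)
    then have "L k = 0" using k by (metis mem_Collect_eq span_eq_iff)
    then have "L z = L y"
      using \<open>z = k + y\<close> by (simp add: linear_add[OF assms])
    moreover have "y \<in> ker_perp L"
      using y by (auto simp: ker_perp_def orthogonal_comp_def orthogonal_commute span_base)
    ultimately show ?thesis by blast
  qed
  then show ?thesis by blast
qed

lemma induced_metric_isometry:
  assumes "linear (X x)" "a \<in> ker_perp (X x)" "b \<in> ker_perp (X x)"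
  shows "induced_metric X x (X x a) (X x b) = a \<bullet> b"
  using assms by (simp add: induced_metric_def inv_into_f_f inj_on_ker_perp)

definition adjoint_map ::
  "('a \<Rightarrow> 'h::euclidean_space \<Rightarrow> ('a, 'e::real_vector) tvec) \<Rightarrow> 'a \<Rightarrow> ('a, 'e) tvec \<Rightarrow> 'h" where
  "adjoint_map X x v = (THE y. \<forall>a. y \<bullet> a = induced_metric X x v (X x a))"

text \<open>\<open>lw_nabla A X v Z x\<close> is the covariant derivative of the vector field \<open>Z\<close> in the direction of
  the vector \<open>v\<close> tangent at \<open>x\<close>.\<close>

definition lw_nabla ::
  "('a, 'e::euclidean_space) chart set \<Rightarrow> ('a \<Rightarrow> 'h::euclidean_space \<Rightarrow> ('a, 'e) tvec) \<Rightarrow>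
     ('a, 'e) tvec \<Rightarrow> ('a \<Rightarrow> ('a, 'e) tvec) \<Rightarrow> 'a \<Rightarrow> ('a, 'e) tvec" where
  "lw_nabla A X v Z x = X x (differential A (\<lambda>y. adjoint_map X y (Z y)) x v)"

definition lw_curvature_fields ::
  "('a, 'e::euclidean_space) chart set \<Rightarrow> ('a \<Rightarrow> 'h::euclidean_space \<Rightarrow> ('a, 'e) tvec) \<Rightarrow>
     ('a \<Rightarrow> ('a, 'e) tvec) \<Rightarrow> ('a \<Rightarrow> ('a, 'e) tvec) \<Rightarrow> ('a \<Rightarrow> ('a, 'e) tvec) \<Rightarrow>
     'a \<Rightarrow> ('a, 'e) tvec" where
  "lw_curvature_fields A X U V W x =
     lw_nabla A X (U x) (\<lambda>y. lw_nabla A X (V y) W y) x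
   - lw_nabla A X (V x) (\<lambda>y. lw_nabla A X (U y) W y) x
   - lw_nabla A X (lie_bracket A U V x) W x"

text \<open>The curvature tensor at \<open>x\<close> on tangent vectors \<open>u, v, w\<close>: the common value at \<open>x\<close> of the
  curvature of all smooth vector fields \<open>U, V, W\<close>, defined on some open neighbourhood of \<open>x\<close>
  (in particular, on all of \<open>M\<close>), that extend \<open>u, v, w\<close>.\<close>

definition lw_curvature ::
  "'a topology \<Rightarrow> ('a, 'e::euclidean_space) chart set \<Rightarrow>
     ('a \<Rightarrow> 'h::euclidean_space \<Rightarrow> ('a, 'e) tvec) \<Rightarrow>
     'a \<Rightarrow> ('a, 'e) tvec \<Rightarrow> ('a, 'e) tvec \<Rightarrow> ('a, 'e) tvec \<Rightarrow> ('a, 'e) tvec" where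
  "lw_curvature T A X x u v w = (THE r. \<forall>N U V W.
     openin T N \<and> x \<in> N \<and>
     smooth_vector_field A N U \<and> smooth_vector_field A N V \<and> smooth_vector_field A N W \<and>
     U x = u \<and> V x = v \<and> W x = w \<longrightarrow>
     lw_curvature_fields A X U V W x = r)"

end

theory Submission
  imports Defs
begin

text \<open>Let \<open>P x = Y x \<circ> X x\<close> be the orthogonal projection of \<open>\<real>\<^sup>m\<close> onto the complement of the kernel
  of \<open>X x\<close>, and let \<open>f = Y W\<close>. Then \<open>Y (\<nabla>\<^sub>V W) = P (df V)\<close>, so the second derivatives of \<open>f\<close> and the bracket
  term cancel in \<open>R(U, V) W\<close> and leave \<open>X (dP(U) df(V) - dP(V) df(U))\<close>. Differentiating \<open>P P = P\<close> gives
  \<open>P dP P = 0\<close>, and differentiating \<open>P f = f\<close> gives \<open>df = dP f + P df\<close>; since \<open>X = X P\<close>, the curvature is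
  \<open>X [dP(U), dP(V)] Y W\<close>. On the other side \<open>\<nabla>\<^sub>v X\<^sup>i = X (dP(v) e\<^sub>i)\<close>, and \<open>dP(v)\<close> is symmetric, so expanding
  in the orthonormal basis gives the same expression.\<close>

section \<open>Functions of class \<open>C\<^sup>k\<close>\<close>

text \<open>Since \<open>S\<close> is open, agreement on \<open>S\<close> is agreement near each of
  its points, so the Frechet derivatives agree as well and the induction passes to them.\<close>

lemma Ck_on_cong:
  assumes "open S" "Ck_on k S f" "\<And>p. p \<in> S \<Longrightarrow> f p = g p"
  shows "Ck_on k S g"
  using assms(2,3)
proof (induction k arbitrary: f g)
  case 0
  then show ?case
    by (metis Ck_on.simps(1) continuous_on_cong)
next
  case (Suc k)
  have d: "(g has_derivative frechet_derivative f (at p)) (at p)" if "p \<in> S" for p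
    using Suc.prems that
    by (auto intro: has_derivative_transform_within_open[OF _ assms(1)] simp: frechet_derivative_works)
  have "frechet_derivative f (at p) = frechet_derivative g (at p)" if "p \<in> S" for p
    using frechet_derivative_at[OF d[OF that]] .
  then have "Ck_on k S (\<lambda>p. frechet_derivative g (at p) h)" for h
    using Suc.prems(1) by (auto intro: Suc.IH)
  then show ?case
    using d by (auto intro: differentiableI)
qed

text \<open>Allows an explicit derivative formula, such as the product rule, in place of
  \<open>frechet_derivative\<close> in the closure proofs below.\<close>

lemma Ck_on_SucI:
  assumes "open S" "\<And>p. p \<in> S \<Longrightarrow> (f has_derivative f' p) (at p)"
    and "\<And>h. Ck_on k S (\<lambda>p. f' p h)"
  shows "Ck_on (Suc k) S f"
proof -
  have "Ck_on k S (\<lambda>p. frechet_derivative f (at p) h)" for h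
    by (rule Ck_on_cong[OF assms(1) assms(3)[of h]]) (simp add: frechet_derivative_at[OF assms(2)])
  then show ?thesis
    using assms(2) by (auto intro: differentiableI)
qed

lemma Ck_on_has_derivative:
  assumes "Ck_on (Suc k) S f" "p \<in> S"
  shows "(f has_derivative frechet_derivative f (at p)) (at p)"
  using assms by (simp add: frechet_derivative_works)

lemma Ck_on_SucD: "Ck_on (Suc k) S f \<Longrightarrow> Ck_on k S f"
proof (induction k arbitrary: f)
  case 0
  then show ?case
    by (auto intro!: continuous_at_imp_continuous_on differentiable_imp_continuous_within)
next
  case (Suc k)
  then show ?case
    by (metis Ck_on.simps(2))
qed

lemma Ck_on_const: "open S \<Longrightarrow> Ck_on k S (\<lambda>_. a)"
  by (induction k arbitrary: a) auto

lemma Ck_on_bounded_linear: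
  assumes "open S" "bounded_linear L" "Ck_on k S f"
  shows "Ck_on k S (\<lambda>p. L (f p))"
  using assms(3)
proof (induction k arbitrary: f)
  case 0
  then show ?case
    by (simp add: bounded_linear.continuous_on[OF assms(2)])
next
  case (Suc k)
  show ?case
  proof (rule Ck_on_SucI[OF assms(1)])
    show "((\<lambda>p. L (f p)) has_derivative (\<lambda>h. L (frechet_derivative f (at p) h))) (at p)"
      if "p \<in> S" for p
      by (rule bounded_linear.has_derivative[OF assms(2) Ck_on_has_derivative[OF Suc.prems that]])
    show "Ck_on k S (\<lambda>p. L (frechet_derivative f (at p) h))" for h
      using Suc.prems by (auto intro: Suc.IH)
  qed
qed

lemma Ck_on_add:
  assumes "open S" "Ck_on k S f" "Ck_on k S g"
  shows "Ck_on k S (\<lambda>p. f p + g p)"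
  using assms(2,3)
proof (induction k arbitrary: f g)
  case 0
  then show ?case
    by (simp add: continuous_on_add)
next
  case (Suc k)
  show ?case
  proof (rule Ck_on_SucI[OF assms(1)])
    show "((\<lambda>p. f p + g p) has_derivative
        (\<lambda>h. frechet_derivative f (at p) h + frechet_derivative g (at p) h)) (at p)" if "p \<in> S" for p
      using Ck_on_has_derivative[OF Suc.prems(1) that] Ck_on_has_derivative[OF Suc.prems(2) that]
      by (rule has_derivative_add)
    show "Ck_on k S (\<lambda>p. frechet_derivative f (at p) h + frechet_derivative g (at p) h)" for h
      using Suc.prems by (auto intro: Suc.IH)
  qed
qed

lemma Ck_on_bilinear:
  assumes "open S" "bounded_bilinear b" "Ck_on k S f" "Ck_on k S g"
  shows "Ck_on k S (\<lambda>p. b (f p) (g p))"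
  using assms(3,4)
proof (induction k arbitrary: f g)
  case 0
  then show ?case
    by (simp add: bounded_bilinear.continuous_on[OF assms(2)])
next
  case (Suc k)
  show ?case
  proof (rule Ck_on_SucI[OF assms(1)])
    show "((\<lambda>p. b (f p) (g p)) has_derivative
        (\<lambda>h. b (f p) (frechet_derivative g (at p) h) + b (frechet_derivative f (at p) h) (g p))) (at p)"
      if "p \<in> S" for p
      using Ck_on_has_derivative[OF Suc.prems(1) that] Ck_on_has_derivative[OF Suc.prems(2) that]
      by (rule bounded_bilinear.FDERIV[OF assms(2)])
    \<comment> \<open>The product rule leaves one factor undifferentiated; \<open>Ck_on_SucD\<close>
      lowers its class so that the induction hypothesis applies to it.\<close>
    show "Ck_on k S (\<lambda>p. b (f p) (frechet_derivative g (at p) h) + b (frechet_derivative f (at p) h) (g p))" for h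
      using Suc.prems Suc.prems[THEN Ck_on_SucD] by (auto intro!: Suc.IH Ck_on_add[OF assms(1)])
  qed
qed

text \<open>The derivative of \<open>inverse f\<close> is a polynomial in \<open>inverse f\<close>
  and the derivative of \<open>f\<close>, so each induction step gains one class.\<close>

lemma Ck_on_inverse:
  fixes f :: "'e::euclidean_space \<Rightarrow> real"
  assumes "open S" "Ck_on k S f" "\<And>p. p \<in> S \<Longrightarrow> f p \<noteq> 0"
  shows "Ck_on k S (\<lambda>p. inverse (f p))"
  using assms(2)
proof (induction k)
  case 0
  then show ?case
    using assms(3) by (auto intro: continuous_on_inverse)
next
  case (Suc k)
  show ?case
  proof (rule Ck_on_SucI[OF assms(1)])
    show "((\<lambda>p. inverse (f p)) has_derivative
        (\<lambda>h. - (inverse (f p) * frechet_derivative f (at p) h * inverse (f p)))) (at p)" if "p \<in> S" for p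
      by (rule Deriv.has_derivative_inverse[OF assms(3)[OF that] Ck_on_has_derivative[OF Suc.prems that]])
    have "Ck_on k S (\<lambda>p. inverse (f p))"
      using Suc Ck_on_SucD by blast
    moreover have "Ck_on k S (\<lambda>p. frechet_derivative f (at p) h)" for h
      using Suc.prems by auto
    ultimately show "Ck_on k S (\<lambda>p. - (inverse (f p) * frechet_derivative f (at p) h * inverse (f p)))" for h
      by (intro Ck_on_bounded_linear[OF assms(1) bounded_linear_minus[OF bounded_linear_ident]]
          Ck_on_bilinear[OF assms(1) bounded_bilinear_mult])
  qed
qed

lemma Ck_on_sum:
  assumes "open S" "\<And>i. i \<in> I \<Longrightarrow> Ck_on k S (f i)"
  shows "Ck_on k S (\<lambda>p. \<Sum>i\<in>I. f i p)"
  using assms(2)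
  by (induction I rule: infinite_finite_induct) (auto intro: Ck_on_const Ck_on_add assms(1))

lemma Ck_on_prod:
  fixes f :: "'i \<Rightarrow> 'e::euclidean_space \<Rightarrow> real"
  assumes "open S" "\<And>i. i \<in> I \<Longrightarrow> Ck_on k S (f i)"
  shows "Ck_on k S (\<lambda>p. \<Prod>i\<in>I. f i p)"
  using assms(2)
  by (induction I rule: infinite_finite_induct)
     (auto intro: Ck_on_const Ck_on_bilinear[OF _ bounded_bilinear_mult] assms(1))

section \<open>Vector- and matrix-valued functions\<close>

lemma bounded_linear_axis: "bounded_linear (axis i :: 'b::real_normed_vector \<Rightarrow> 'b ^ 'i)"
proof (rule bounded_linear_intro[where K = 1])
  show "norm (axis i x :: 'b ^ 'i) \<le> norm x * 1" for x :: 'b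
    by (simp add: norm_vec_def L2_set_def axis_def if_distrib[of norm] if_distrib[of "\<lambda>x. x\<^sup>2"] cong: if_cong)
qed (auto simp: axis_def vec_eq_iff)

lemma Ck_on_vec_lambda:
  fixes f :: "'i::finite \<Rightarrow> 'e::euclidean_space \<Rightarrow> 'b::real_normed_vector"
  assumes "open S" "\<And>i. Ck_on k S (f i)"
  shows "Ck_on k S (\<lambda>p. \<chi> i. f i p)"
proof (rule Ck_on_cong[OF assms(1)])
  show "Ck_on k S (\<lambda>p. \<Sum>i\<in>UNIV. axis i (f i p))"
    by (intro Ck_on_sum Ck_on_bounded_linear[OF _ bounded_linear_axis] assms)
qed (simp add: vec_eq_iff axis_def)

lemma Ck_on_vec_nth:
  assumes "open S" "Ck_on k S f"
  shows "Ck_on k S (\<lambda>p. f p $ i)"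
  by (rule Ck_on_bounded_linear[OF assms(1) bounded_linear_vec_nth assms(2)])

lemma Ck_on_det:
  fixes B :: "'e::euclidean_space \<Rightarrow> real ^ 'n ^ 'n"
  assumes "open S" "\<And>i j. Ck_on k S (\<lambda>p. B p $ i $ j)"
  shows "Ck_on k S (\<lambda>p. det (B p))"
  unfolding det_def
  by (intro Ck_on_sum Ck_on_prod Ck_on_bilinear[OF _ bounded_bilinear_mult] Ck_on_const assms)

text \<open>Cramer's rule exhibits the solution as a rational function of the coefficients.\<close>

lemma Ck_on_linear_solve:
  fixes B :: "'e::euclidean_space \<Rightarrow> real ^ 'n ^ 'n"
  assumes "open S" "Ck_on k S B" "Ck_on k S b"
    and inv: "\<And>p. p \<in> S \<Longrightarrow> invertible (B p)"
    and solve: "\<And>p. p \<in> S \<Longrightarrow> B p *v z p = b p"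
  shows "Ck_on k S z"
proof (rule Ck_on_cong[OF assms(1)])
  have B: "Ck_on k S (\<lambda>p. B p $ i $ j)" and b: "Ck_on k S (\<lambda>p. b p $ i)" for i j
    by (intro Ck_on_vec_nth assms)+
  \<comment> \<open>Replacing column \<open>l\<close> of \<open>B p\<close> by \<open>b p\<close>
    gives the numerator matrix for the unknown \<open>l\<close> in Cramer's rule.\<close>
  have "Ck_on k S (\<lambda>p. if j = l then b p $ i else B p $ i $ j)" for i j l
    using B b by (cases "j = l") auto
  then have "Ck_on k S (\<lambda>p. det (\<chi> i j. if j = l then b p $ i else B p $ i $ j) * inverse (det (B p)))" for l
    using inv
    by (intro Ck_on_bilinear[OF _ bounded_bilinear_mult] Ck_on_inverse Ck_on_det B assms(1))
       (auto simp: invertible_det_nz)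
  then show "Ck_on k S (\<lambda>p. \<chi> l. det (\<chi> i j. if j = l then b p $ i else B p $ i $ j) * inverse (det (B p)))"
    by (intro Ck_on_vec_lambda assms(1))
  show "(\<chi> l. det (\<chi> i j. if j = l then b p $ i else B p $ i $ j) * inverse (det (B p))) = z p"
    if "p \<in> S" for p
    using cramer[of "B p" "z p" "b p"] inv[OF that] solve[OF that]
    by (simp add: invertible_det_nz divide_inverse)
qed

lemma bounded_bilinear_matrix_vector_mult:
  "bounded_bilinear ((*v) :: real ^ 'm ^ 'n \<Rightarrow> real ^ 'm \<Rightarrow> real ^ 'n)"
  by (rule bilinear_conv_bounded_bilinear[THEN iffD1])
     (simp add: bilinear_def linear_iff matrix_vector_mult_add_rdistrib vec.add vec.scale scaleR_matrix_vector_assoc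
       vector_scaleR_matrix_ac matrix_vector_mult_scaleR matrix_vector_right_distrib)

lemma bounded_bilinear_matrix_matrix_mult:
  "bounded_bilinear ((**) :: real ^ 'm ^ 'n \<Rightarrow> real ^ 'k ^ 'm \<Rightarrow> real ^ 'k ^ 'n)"
  by (rule bilinear_conv_bounded_bilinear[THEN iffD1])
     (simp add: bilinear_def linear_iff matrix_matrix_mult_def vec_eq_iff sum.distrib algebra_simps sum_distrib_left)

lemma bounded_linear_transpose: "bounded_linear (transpose :: real ^ 'm ^ 'n \<Rightarrow> real ^ 'n ^ 'm)"
  by (rule linear_conv_bounded_linear[THEN iffD1]) (simp add: linear_iff transpose_def vec_eq_iff)

section \<open>Symmetry of second derivatives\<close>

lemma second_difference_mvt:
  fixes f :: "'e::euclidean_space \<Rightarrow> real"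
  assumes s: "s > 0"
    and S: "\<And>a b. 0 \<le> a \<Longrightarrow> a \<le> s \<Longrightarrow> 0 \<le> b \<Longrightarrow> b \<le> s \<Longrightarrow> p + a *\<^sub>R u + b *\<^sub>R v \<in> S"
    and f: "\<And>q. q \<in> S \<Longrightarrow> (f has_derivative f' q) (at q)"
    and g: "\<And>q. q \<in> S \<Longrightarrow> ((\<lambda>q. f' q u) has_derivative g q) (at q)"
  obtains a b where "0 < a" "a < s" "0 < b" "b < s"
    "f (p + s *\<^sub>R u + s *\<^sub>R v) - f (p + s *\<^sub>R u) - f (p + s *\<^sub>R v) + f p = s * s * g (p + a *\<^sub>R u + b *\<^sub>R v) v"
proof -
  \<comment> \<open>The second difference is the increment \<open>G s - G 0\<close>. A mean value
    step in the direction \<open>u\<close> turns it into an increment of the derivative along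
    \<open>u\<close>, and a second one, in the direction \<open>v\<close>, then applies to
    \<open>H\<close>.\<close>
  define G where "G a = f (p + a *\<^sub>R u + s *\<^sub>R v) - f (p + a *\<^sub>R u)" for a
  have lin: "f' q (h *\<^sub>R x) = h * f' q x" "g q (h *\<^sub>R x) = h * g q x" if "q \<in> S" for q h x
    using linear_scale[OF has_derivative_linear[OF f[OF that]]]
      linear_scale[OF has_derivative_linear[OF g[OF that]]] by auto
  have dG: "(G has_derivative (\<lambda>h. f' (p + a *\<^sub>R u + s *\<^sub>R v) (h *\<^sub>R u) - f' (p + a *\<^sub>R u) (h *\<^sub>R u))) (at a)"
    if "0 \<le> a" "a \<le> s" for a
    unfolding G_def using S[of a s] S[of a 0] that s
    by (auto intro!: derivative_eq_intros has_derivative_compose[OF _ f])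
  have "DERIV G a :> f' (p + a *\<^sub>R u + s *\<^sub>R v) u - f' (p + a *\<^sub>R u) u" if "0 \<le> a" "a \<le> s" for a
  proof -
    have "(\<lambda>h. f' (p + a *\<^sub>R u + s *\<^sub>R v) (h *\<^sub>R u) - f' (p + a *\<^sub>R u) (h *\<^sub>R u)) =
        (*) (f' (p + a *\<^sub>R u + s *\<^sub>R v) u - f' (p + a *\<^sub>R u) u)"
      using S[of a s] S[of a 0] that s by (simp add: lin fun_eq_iff left_diff_distrib)
    with dG[OF that] show ?thesis
      by (simp add: has_field_derivative_def)
  qed
  from MVT2[OF s this] obtain a where a: "0 < a" "a < s"
    and Ga: "G s - G 0 = s * (f' (p + a *\<^sub>R u + s *\<^sub>R v) u - f' (p + a *\<^sub>R u) u)" by auto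
  define H where "H b = f' (p + a *\<^sub>R u + b *\<^sub>R v) u" for b
  have dH: "(H has_derivative (\<lambda>h. g (p + a *\<^sub>R u + b *\<^sub>R v) (h *\<^sub>R v))) (at b)"
    if "0 \<le> b" "b \<le> s" for b
    unfolding H_def using S[of a b] that a
    by (auto intro!: derivative_eq_intros has_derivative_compose[OF _ g])
  have "DERIV H b :> g (p + a *\<^sub>R u + b *\<^sub>R v) v" if "0 \<le> b" "b \<le> s" for b
  proof -
    have "(\<lambda>h. g (p + a *\<^sub>R u + b *\<^sub>R v) (h *\<^sub>R v)) = (*) (g (p + a *\<^sub>R u + b *\<^sub>R v) v)"
      using S[of a b] that a by (simp add: lin fun_eq_iff)
    with dH[OF that] show ?thesis
      by (simp add: has_field_derivative_def)
  qed
  from MVT2[OF s this] obtain b where b: "0 < b" "b < s"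
    and Hb: "H s - H 0 = s * g (p + a *\<^sub>R u + b *\<^sub>R v) v" by auto
  show ?thesis
    using that[OF a b] Ga Hb by (simp add: G_def H_def)
qed

text \<open>Both second derivatives are limits of the same second difference quotient.\<close>

lemma second_derivative_symmetric_real:
  fixes f :: "'e::euclidean_space \<Rightarrow> real"
  assumes "open S" "Ck_on 2 S f" "p \<in> S"
  shows "frechet_derivative (\<lambda>q. frechet_derivative f (at q) u) (at p) v =
    frechet_derivative (\<lambda>q. frechet_derivative f (at q) v) (at p) u"
proof -
  let ?D = "\<lambda>u q. frechet_derivative f (at q) u"
  let ?E = "\<lambda>u v q. frechet_derivative (?D u) (at q) v"
  have d: "(f has_derivative (\<lambda>u. ?D u q)) (at q)" "(?D u has_derivative (\<lambda>v. ?E u v q)) (at q)"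
    "isCont (?E u v) q" if "q \<in> S" for q u v
    using assms(1,2) that
    by (simp_all add: numeral_2_eq_2 frechet_derivative_works[symmetric] continuous_on_eq_continuous_at)
  \<comment> \<open>Continuity at \<open>p\<close> puts the two intermediate values of the second
    derivatives within half of \<epsilon> of their values at \<open>p\<close>, and the intermediate
    values coincide.\<close>
  have "\<bar>?E u v p - ?E v u p\<bar> \<le> \<epsilon>" if "\<epsilon> > 0" for \<epsilon>
  proof -
    obtain \<delta>1 where \<delta>1: "\<delta>1 > 0" "ball p \<delta>1 \<subseteq> S"
      using assms(1,3) open_contains_ball by blast
    obtain \<delta>2 where \<delta>2: "\<delta>2 > 0" "\<And>q. dist q p < \<delta>2 \<Longrightarrow> dist (?E u v q) (?E u v p) < \<epsilon> / 2"
      using d(3)[OF assms(3), of u v] \<open>\<epsilon> > 0\<close> unfolding continuous_at_eps_delta by (meson half_gt_zero)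
    obtain \<delta>3 where \<delta>3: "\<delta>3 > 0" "\<And>q. dist q p < \<delta>3 \<Longrightarrow> dist (?E v u q) (?E v u p) < \<epsilon> / 2"
      using d(3)[OF assms(3), of v u] \<open>\<epsilon> > 0\<close> unfolding continuous_at_eps_delta by (meson half_gt_zero)
    define \<delta> where "\<delta> = min \<delta>1 (min \<delta>2 \<delta>3)"
    \<comment> \<open>With this side length the whole parallelogram lies within \<delta> of
      \<open>p\<close>; the summand 1 keeps the denominator positive when \<open>u\<close> and
      \<open>v\<close> are both zero.\<close>
    define s where "s = \<delta> / (norm u + norm v + 1)"
    have "\<delta> > 0"
      using \<delta>1 \<delta>2 \<delta>3 by (simp add: \<delta>_def)
    then have s: "s > 0"
      by (simp add: s_def add_nonneg_pos)
    have near: "dist (p + a *\<^sub>R u + b *\<^sub>R v) p < \<delta>" if "0 \<le> a" "a \<le> s" "0 \<le> b" "b \<le> s" for a b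
    proof -
      have "dist (p + a *\<^sub>R u + b *\<^sub>R v) p = norm (a *\<^sub>R u + b *\<^sub>R v)"
        by (simp add: dist_norm algebra_simps)
      also have "\<dots> \<le> a * norm u + b * norm v"
        using norm_triangle_ineq[of "a *\<^sub>R u" "b *\<^sub>R v"] that by simp
      also have "\<dots> \<le> s * norm u + s * norm v"
        using that by (intro add_mono mult_right_mono) auto
      also have "\<dots> < s * (norm u + norm v + 1)"
        using s by (simp add: algebra_simps)
      also have "\<dots> = \<delta>"
        by (simp add: s_def add_nonneg_eq_0_iff add_nonneg_pos less_imp_neq[symmetric])
      finally show ?thesis .
    qed
    have inS: "p + a *\<^sub>R u + b *\<^sub>R v \<in> S" "p + b *\<^sub>R v + a *\<^sub>R u \<in> S"
      if "0 \<le> a" "a \<le> s" "0 \<le> b" "b \<le> s" for a b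
      using near[OF that] \<delta>1(2) by (auto simp: \<delta>_def dist_commute add.commute add.left_commute)
    obtain a b where ab: "0 < a" "a < s" "0 < b" "b < s"
      "f (p + s *\<^sub>R u + s *\<^sub>R v) - f (p + s *\<^sub>R u) - f (p + s *\<^sub>R v) + f p = s * s * ?E u v (p + a *\<^sub>R u + b *\<^sub>R v)"
      by (rule second_difference_mvt[OF s, of p u v S f "\<lambda>q u. ?D u q" "\<lambda>q v. ?E u v q"])
         (use inS d in auto)
    \<comment> \<open>Interchanging \<open>u\<close> and \<open>v\<close> leaves the second
      difference unchanged but reverses the order of differentiation.\<close>
    obtain b' a' where ab': "0 < b'" "b' < s" "0 < a'" "a' < s"
      "f (p + s *\<^sub>R v + s *\<^sub>R u) - f (p + s *\<^sub>R v) - f (p + s *\<^sub>R u) + f p = s * s * ?E v u (p + b' *\<^sub>R v + a' *\<^sub>R u)"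
      by (rule second_difference_mvt[OF s, of p v u S f "\<lambda>q u. ?D u q" "\<lambda>q u. ?E v u q"])
         (use inS d in auto)
    have "s * s * ?E u v (p + a *\<^sub>R u + b *\<^sub>R v) = s * s * ?E v u (p + a' *\<^sub>R u + b' *\<^sub>R v)"
    proof -
      have *: "p + s *\<^sub>R v + s *\<^sub>R u = p + s *\<^sub>R u + s *\<^sub>R v" "p + b' *\<^sub>R v + a' *\<^sub>R u = p + a' *\<^sub>R u + b' *\<^sub>R v"
        by (simp_all add: algebra_simps)
      show ?thesis
        using ab(5) ab'(5)[unfolded *] by linarith
    qed
    then have "?E u v (p + a *\<^sub>R u + b *\<^sub>R v) = ?E v u (p + a' *\<^sub>R u + b' *\<^sub>R v)"
      using s by simp
    moreover have "dist (?E u v (p + a *\<^sub>R u + b *\<^sub>R v)) (?E u v p) < \<epsilon> / 2"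
      using near[of a b] ab by (intro \<delta>2) (auto simp: \<delta>_def)
    moreover have "dist (?E v u (p + a' *\<^sub>R u + b' *\<^sub>R v)) (?E v u p) < \<epsilon> / 2"
      using near[of a' b'] ab' by (intro \<delta>3) (auto simp: \<delta>_def)
    ultimately show ?thesis
      unfolding dist_real_def by linarith
  qed
  then have "\<bar>?E u v p - ?E v u p\<bar> \<le> 0"
    by (rule field_le_epsilon) simp
  then show ?thesis by simp
qed

lemma frechet_derivative_inner_left:
  assumes "f differentiable (at p)"
  shows "frechet_derivative (\<lambda>q. f q \<bullet> b) (at p) h = frechet_derivative f (at p) h \<bullet> b"
proof -
  have "((\<lambda>q. f q \<bullet> b) has_derivative (\<lambda>h. frechet_derivative f (at p) h \<bullet> b)) (at p)"
    using assms by (intro has_derivative_inner_left) (simp add: frechet_derivative_works)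
  from frechet_derivative_at[OF this, symmetric] show ?thesis by simp
qed

text \<open>Reduces to the real case, because the inner product with a fixed basis vector commutes
  with differentiation.\<close>

lemma second_derivative_symmetric:
  fixes f :: "'e::euclidean_space \<Rightarrow> 'f::euclidean_space"
  assumes "open S" "Ck_on 2 S f" "p \<in> S"
  shows "frechet_derivative (\<lambda>q. frechet_derivative f (at q) u) (at p) v =
    frechet_derivative (\<lambda>q. frechet_derivative f (at q) v) (at p) u"
proof (rule euclidean_eqI)
  fix b :: 'f
  let ?fb = "\<lambda>q. f q \<bullet> b"
  have "Ck_on 2 S ?fb"
    by (rule Ck_on_bounded_linear[OF assms(1) bounded_linear_inner_left assms(2)])
  note sym = second_derivative_symmetric_real[OF assms(1) this assms(3), of u v]
  have "frechet_derivative (\<lambda>q. frechet_derivative ?fb (at q) u) (at p) v =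
      frechet_derivative (\<lambda>q. frechet_derivative f (at q) u) (at p) v \<bullet> b" for u v
  proof -
    have diff: "(\<lambda>q. frechet_derivative f (at q) u) differentiable (at p)"
      using assms(2,3) by (simp add: numeral_2_eq_2)
    have eq: "frechet_derivative f (at q) u \<bullet> b = frechet_derivative ?fb (at q) u" if "q \<in> S" for q
      using assms(2) that by (simp add: numeral_2_eq_2 frechet_derivative_inner_left)
    have "(\<lambda>q. frechet_derivative f (at q) u \<bullet> b) differentiable (at p)"
      using diff bounded_linear.has_derivative[OF bounded_linear_inner_left]
      unfolding differentiable_def by blast
    then have "frechet_derivative (\<lambda>q. frechet_derivative f (at q) u \<bullet> b) (at p) =
        frechet_derivative (\<lambda>q. frechet_derivative ?fb (at q) u) (at p)"
      by (rule frechet_derivative_transform_within_open[OF _ assms(1,3)]) (rule eq)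
    then show ?thesis
      by (simp add: frechet_derivative_inner_left[OF diff, symmetric])
  qed
  with sym show "frechet_derivative (\<lambda>q. frechet_derivative f (at q) u) (at p) v \<bullet> b =
    frechet_derivative (\<lambda>q. frechet_derivative f (at q) v) (at p) u \<bullet> b"
    by metis
qed


text \<open>Class C^2 differentiates \<open>frechet_derivative f (at q) b\<close> only for a fixed
  direction \<open>b\<close>. Expanding the moving direction \<open>V q\<close> in
  \<open>Basis\<close> leaves finitely many fixed ones, and the product rule applies to each
  summand.\<close>

lemma has_derivative_directional:
  fixes f :: "'e::euclidean_space \<Rightarrow> 'f::real_normed_vector"
  assumes "open S" "Ck_on 2 S f" "p \<in> S" and V: "(V has_derivative V') (at p)"
  shows "((\<lambda>q. frechet_derivative f (at q) (V q)) has_derivative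
    (\<lambda>h. frechet_derivative (\<lambda>q. frechet_derivative f (at q) (V p)) (at p) h
      + frechet_derivative f (at p) (V' h))) (at p)"
proof -
  let ?D = "\<lambda>q. frechet_derivative f (at q)"
  let ?E = "\<lambda>b. frechet_derivative (\<lambda>q. ?D q b) (at p)"
  have lin: "linear (?D q)" if "q \<in> S" for q
    using assms(2) that by (intro linear_frechet_derivative) (simp add: numeral_2_eq_2)
  have E: "((\<lambda>q. ?D q b) has_derivative ?E b) (at p)" for b
    using assms(2,3) by (simp add: numeral_2_eq_2 frechet_derivative_works[symmetric])
  have expand: "(\<Sum>b\<in>Basis. (k \<bullet> b) *\<^sub>R ?D q b) = ?D q k" if "q \<in> S" for q k
    using linear_sum[OF lin[OF that], of "\<lambda>b. (k \<bullet> b) *\<^sub>R b" Basis]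
    by (simp add: linear_scale[OF lin[OF that]] euclidean_representation)
  \<comment> \<open>With the coefficients frozen at \<open>p\<close>, the second derivatives along
    basis vectors reassemble into the one along \<open>V p\<close>, by uniqueness of the
    derivative.\<close>
  have eq: "(\<Sum>b\<in>Basis. (V p \<bullet> b) *\<^sub>R ?E b h) = ?E (V p) h" for h
  proof -
    have "((\<lambda>q. \<Sum>b\<in>Basis. (V p \<bullet> b) *\<^sub>R ?D q b) has_derivative
        (\<lambda>h. \<Sum>b\<in>Basis. (V p \<bullet> b) *\<^sub>R ?E b h)) (at p)"
      by (rule has_derivative_sum) (rule has_derivative_scaleR_right[OF E])
    then have "((\<lambda>q. ?D q (V p)) has_derivative (\<lambda>h. \<Sum>b\<in>Basis. (V p \<bullet> b) *\<^sub>R ?E b h)) (at p)"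
      by (rule has_derivative_transform_within_open[OF _ assms(1,3)]) (rule expand)
    from frechet_derivative_at[OF this] show ?thesis by (rule fun_cong)
  qed
  have "((\<lambda>q. \<Sum>b\<in>Basis. (V q \<bullet> b) *\<^sub>R ?D q b) has_derivative
      (\<lambda>h. \<Sum>b\<in>Basis. (V p \<bullet> b) *\<^sub>R ?E b h + (V' h \<bullet> b) *\<^sub>R ?D p b)) (at p)"
    by (rule has_derivative_sum) (rule has_derivative_scaleR[OF has_derivative_inner_left[OF V] E])
  then have "((\<lambda>q. \<Sum>b\<in>Basis. (V q \<bullet> b) *\<^sub>R ?D q b) has_derivative (\<lambda>h. ?E (V p) h + ?D p (V' h))) (at p)"
    by (simp only: sum.distrib eq expand[OF assms(3)])
  then show ?thesis
    by (rule has_derivative_transform_within_open[OF _ assms(1,3)]) (rule expand)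
qed

lemma inner_transpose_matrix: "(transpose B *v z) \<bullet> a = z \<bullet> (B *v a)"
  for B :: "real ^ 'm ^ 'n"
  by (simp add: dot_lmul_matrix)

section \<open>Families of projections\<close>

lemma derivative_projection:
  fixes P :: "'e::euclidean_space \<Rightarrow> real ^ 'm ^ 'm"
  assumes "open S" "p \<in> S" and P: "(P has_derivative P') (at p)"
    and idem: "\<And>q. q \<in> S \<Longrightarrow> P q ** P q = P q"
  shows "P p ** P' h ** P p = 0"
proof -
  have "((\<lambda>q. P q ** P q) has_derivative (\<lambda>h. P p ** P' h + P' h ** P p)) (at p)"
    by (rule bounded_bilinear.FDERIV[OF bounded_bilinear_matrix_matrix_mult P P])
  then have "(P has_derivative (\<lambda>h. P p ** P' h + P' h ** P p)) (at p)"
    by (rule has_derivative_transform_within_open[OF _ assms(1,2)]) (rule idem)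
  then have *: "P' h = P p ** P' h + P' h ** P p"
    by (rule fun_cong[OF has_derivative_unique[OF P]])
  \<comment> \<open>After multiplication by \<open>P p\<close> on the left, idempotence makes
    \<open>P p ** P' h\<close> occur on both sides, so it cancels.\<close>
  have "P p ** P' h = P p ** P' h + P p ** P' h ** P p"
    using arg_cong[OF *, of "(**) (P p)"]
    by (simp add: matrix_add_ldistrib matrix_mul_assoc idem[OF assms(2)])
  then show ?thesis by simp
qed

text \<open>The derivative of \<open>f\<close> is traded for its value: in
  \<open>f' k = P p *v f' k + P' k *v f p\<close> the first summand is annihilated by
  \<open>P p ** P' h\<close>. This is what makes the curvature depend on \<open>W\<close> only
  through its value at the point.\<close>

lemma derivative_projection_commutator:
  fixes P :: "'e::euclidean_space \<Rightarrow> real ^ 'm ^ 'm"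
  assumes "open S" "p \<in> S" and P: "(P has_derivative P') (at p)"
    and idem: "\<And>q. q \<in> S \<Longrightarrow> P q ** P q = P q"
    and f: "(f has_derivative f') (at p)" and fix_f: "\<And>q. q \<in> S \<Longrightarrow> P q *v f q = f q"
  shows "P p *v (P' h *v f' k) = P p *v (P' h *v (P' k *v f p))"
proof -
  have "((\<lambda>q. P q *v f q) has_derivative (\<lambda>h. P p *v f' h + P' h *v f p)) (at p)"
    by (rule bounded_bilinear.FDERIV[OF bounded_bilinear_matrix_vector_mult P f])
  then have "(f has_derivative (\<lambda>h. P p *v f' h + P' h *v f p)) (at p)"
    by (rule has_derivative_transform_within_open[OF _ assms(1,2)]) (rule fix_f)
  then have "f' k = P p *v f' k + P' k *v f p"
    by (rule fun_cong[OF has_derivative_unique[OF f]])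
  then have "P p *v (P' h *v f' k) = P p *v (P' h *v (P p *v f' k + P' k *v f p))"
    by (rule arg_cong)
  also have "\<dots> = (P p ** P' h ** P p) *v f' k + P p *v (P' h *v (P' k *v f p))"
    by (simp only: matrix_vector_mul_assoc[symmetric] matrix_vector_right_distrib)
  also have "P p ** P' h ** P p = 0"
    by (rule derivative_projection[OF assms(1-4)])
  finally show ?thesis
    by simp
qed

lemma derivative_transpose:
  fixes P :: "'e::euclidean_space \<Rightarrow> real ^ 'm ^ 'm"
  assumes "open S" "p \<in> S" and P: "(P has_derivative P') (at p)"
    and sym: "\<And>q. q \<in> S \<Longrightarrow> transpose (P q) = P q"
  shows "transpose (P' h) = P' h"
proof -
  have "((\<lambda>q. transpose (P q)) has_derivative (\<lambda>h. transpose (P' h))) (at p)"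
    by (rule bounded_linear.has_derivative[OF bounded_linear_transpose P])
  then have "(P has_derivative (\<lambda>h. transpose (P' h))) (at p)"
    by (rule has_derivative_transform_within_open[OF _ assms(1,2)]) (rule sym)
  from has_derivative_unique[OF this P] show ?thesis
    by (rule fun_cong)
qed

section \<open>Charts and tangent vectors\<close>

lemma tcoord_simps [simp]:
  "tcoord 0 c = 0" "tcoord (s + t) c = tcoord s c + tcoord t c" "tcoord (r *\<^sub>R s) c = r *\<^sub>R tcoord s c"
  by (transfer; simp)+

lemma smooth_manifold_charts:
  assumes "smooth_manifold T A" "c \<in> A"
  shows "is_chart T c"
  using assms by (simp add: smooth_manifold_def)

lemma chart_inj_on:
  assumes "is_chart T c"
  shows "inj_on (cmap c) (cdom c)"
proof -
  have "homeomorphic_map (subtopology T (cdom c)) (top_of_set (cmap c ` cdom c)) (cmap c)"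
    using assms by (simp add: is_chart_def)
  then have "inj_on (cmap c) (topspace (subtopology T (cdom c)))"
    by (rule homeomorphic_imp_injective_map)
  moreover have "topspace (subtopology T (cdom c)) = cdom c"
    using assms openin_subset[of T "cdom c"] by (auto simp: is_chart_def)
  ultimately show ?thesis by simp
qed

lemma chart_open_image:
  assumes "is_chart T c" "openin T N"
  shows "open (cmap c ` (N \<inter> cdom c))"
proof -
  have "openin (subtopology T (cdom c)) (N \<inter> cdom c)"
    using assms(2) openin_subtopology by blast
  moreover have "open_map (subtopology T (cdom c)) (top_of_set (cmap c ` cdom c)) (cmap c)"
    using assms(1) homeomorphic_imp_open_map unfolding is_chart_def by blast
  ultimately have "openin (top_of_set (cmap c ` cdom c)) (cmap c ` (N \<inter> cdom c))"
    by (simp add: open_map_def)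
  then show ?thesis
    using assms(1) openin_open_trans unfolding is_chart_def by blast
qed

lemma transition_differentiable:
  assumes "smooth_manifold T A" "c \<in> charts_at A x" "d \<in> charts_at A x"
  shows "((cmap d \<circ> cinv c) has_derivative frechet_derivative (cmap d \<circ> cinv c) (at (cmap c x))) (at (cmap c x))"
proof -
  have "Ck_on (Suc 0) (cmap c ` (cdom c \<inter> cdom d)) (cmap d \<circ> cinv c)"
    using assms unfolding smooth_manifold_def charts_at_def smooth_on_def by blast
  moreover have "cmap c x \<in> cmap c ` (cdom c \<inter> cdom d)"
    using assms by (auto simp: charts_at_def)
  ultimately show ?thesis
    by (rule Ck_on_has_derivative)
qed

text \<open>The factorisation through the transition map holds only over the overlap of the charts,
  whose image is open, so the chain rule still determines the derivative. Taking a chart map for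
  \<open>f\<close> yields the cocycle rule for transition derivatives.\<close>

lemma has_derivative_change_chart:
  assumes M: "smooth_manifold T A" and c: "c \<in> charts_at A x" and d: "d \<in> charts_at A x"
    and f: "((f \<circ> cinv c) has_derivative f') (at (cmap c x))"
  shows "((f \<circ> cinv d) has_derivative f' \<circ> frechet_derivative (cmap c \<circ> cinv d) (at (cmap d x))) (at (cmap d x))"
proof -
  have charts: "is_chart T c" "is_chart T d" "x \<in> cdom c" "x \<in> cdom d"
    using M c d by (auto simp: charts_at_def smooth_manifold_charts)
  then have "openin T (cdom c)" by (simp add: is_chart_def)
  then have op: "open (cmap d ` (cdom c \<inter> cdom d))"
    by (rule chart_open_image[OF charts(2)])
  have x: "cinv d (cmap d x) = x"
    using charts by (simp add: chart_inj_on)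
  have "(f \<circ> cinv c has_derivative f') (at ((cmap c \<circ> cinv d) (cmap d x)))"
    using f by (simp add: x)
  from diff_chain_at[OF transition_differentiable[OF M d c] this]
  have "((f \<circ> cinv c) \<circ> (cmap c \<circ> cinv d) has_derivative
      f' \<circ> frechet_derivative (cmap c \<circ> cinv d) (at (cmap d x))) (at (cmap d x))" .
  then show ?thesis
    by (rule has_derivative_transform_within_open[OF _ op])
       (use charts in \<open>auto simp: inv_into_f_f chart_inj_on\<close>)
qed

lemma tangent_change_chart:
  assumes "t \<in> tangent_space A x" "c \<in> charts_at A x" "d \<in> charts_at A x"
  shows "tcoord t d = frechet_derivative (cmap d \<circ> cinv c) (at (cmap c x)) (tcoord t c)"
  using assms unfolding tangent_space_def by blast

text \<open>\<open>differential\<close> is computed in a chart picked by choice. The chain rule and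
  the transformation law of tangent vectors cancel, so any convenient chart may replace it.\<close>

lemma differential_chart:
  assumes M: "smooth_manifold T A" and c: "c \<in> charts_at A x"
    and f: "((f \<circ> cinv c) has_derivative f') (at (cmap c x))" and t: "t \<in> tangent_space A x"
  shows "differential A f x t = f' (tcoord t c)"
proof -
  define d where "d = (SOME c. c \<in> charts_at A x)"
  have d: "d \<in> charts_at A x"
    unfolding d_def using c by (rule someI)
  have "differential A f x t = frechet_derivative (f \<circ> cinv d) (at (cmap d x)) (tcoord t d)"
    by (simp add: differential_def d_def Let_def)
  also have "\<dots> = f' (frechet_derivative (cmap c \<circ> cinv d) (at (cmap d x)) (tcoord t d))"
    using fun_cong[OF frechet_derivative_at[OF has_derivative_change_chart[OF M c d f]], of "tcoord t d"]
    by simp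
  also have "\<dots> = f' (tcoord t c)"
    by (simp only: tangent_change_chart[OF t d c])
  finally show ?thesis .
qed

text \<open>The transformation law recovers the coordinates in every chart around \<open>x\<close>
  from those in one; at all other charts a tangent vector is \<open>0\<close> by convention.\<close>

lemma tangent_eqI:
  assumes "s \<in> tangent_space A x" "t \<in> tangent_space A x" "c \<in> charts_at A x" "tcoord s c = tcoord t c"
  shows "s = t"
proof (rule tvec_eqI)
  show "tcoord s d = tcoord t d" for d
  proof (cases "d \<in> charts_at A x")
    case True
    then show ?thesis
      using assms(4) by (simp only: tangent_change_chart[OF assms(1,3)] tangent_change_chart[OF assms(2,3)])
  next
    case False
    then have "tcoord r d = 0" if "r \<in> tangent_space A x" for r
      using that unfolding tangent_space_def by blast
    then show ?thesis
      by (simp only: assms(1,2))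
  qed
qed

lemma tangent_exists:
  fixes A :: "('a, 'e::euclidean_space) chart set"
  assumes M: "smooth_manifold T A" and c: "c \<in> charts_at A x"
  obtains t where "t \<in> tangent_space A x" "tcoord t c = h"
proof -
  let ?D = "\<lambda>c d. frechet_derivative (cmap d \<circ> cinv c) (at (cmap c x))"
  define t :: "('a, 'e) tvec" where "t = Tvec (\<lambda>d. if d \<in> charts_at A x then ?D c d h else 0)"
  have t: "tcoord t d = (if d \<in> charts_at A x then ?D c d h else 0)" for d
    by (simp add: t_def Tvec_inverse)
  have cocycle: "?D d d' (?D c d h) = ?D c d' h" if d: "d \<in> charts_at A x" and d': "d' \<in> charts_at A x" for d d'
    using fun_cong[OF frechet_derivative_at[OF has_derivative_change_chart[OF M d c transition_differentiable[OF M d d']]], of h]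
    by simp
  have ch: "is_chart T c" "x \<in> cdom c"
    using M c by (auto simp: charts_at_def smooth_manifold_charts)
  then have op: "open (cmap c ` cdom c)" by (simp add: is_chart_def)
  \<comment> \<open>\<open>cmap c \<circ> cinv c\<close> is the identity only on the chart image, so
    its derivative comes from comparison with the identity on that open set.\<close>
  have "((\<lambda>p. p) has_derivative (\<lambda>h. h)) (at (cmap c x))" by (rule has_derivative_ident)
  then have "((cmap c \<circ> cinv c) has_derivative (\<lambda>h. h)) (at (cmap c x))"
    by (rule has_derivative_transform_within_open[OF _ op]) (use ch in \<open>auto simp: f_inv_into_f\<close>)
  then have "?D c c h = h"
    using frechet_derivative_at by metis
  then show ?thesis
    using c that[of t] by (simp add: t tangent_space_def cocycle)
qed

section \<open>The induced metric and the adjoint\<close>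

lemma ker_perp_inner: "z \<in> ker_perp L \<Longrightarrow> L k = 0 \<Longrightarrow> k \<bullet> z = 0"
  by (simp add: ker_perp_def orthogonal_comp_def orthogonal_def inner_commute)

text \<open>The representative of \<open>a\<close> orthogonal to the kernel differs from
  \<open>a\<close> by a kernel element, which is orthogonal to \<open>z\<close>; so only one
  argument has to lie in \<open>ker_perp (X x)\<close>.\<close>

lemma induced_metric_ker_perp:
  assumes "linear (X x)" "z \<in> ker_perp (X x)"
  shows "induced_metric X x (X x a) (X x z) = a \<bullet> z"
proof -
  obtain b where b: "b \<in> ker_perp (X x)" "X x a = X x b"
    using image_ker_perp[OF assms(1)] by blast
  have "(b - a) \<bullet> z = 0"
    by (rule ker_perp_inner[OF assms(2)]) (simp add: linear_diff[OF assms(1)] b)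
  then show ?thesis
    using assms b by (simp add: induced_metric_isometry inner_diff_left)
qed

lemma induced_metric_commute: "induced_metric X x s t = induced_metric X x t s"
  by (simp add: induced_metric_def inner_commute)

text \<open>The adjoint of an isometry is its inverse: \<open>z\<close> satisfies the defining
  equation of \<open>adjoint_map\<close>, and nondegeneracy of the inner product makes it the only
  solution.\<close>

lemma adjoint_map_ker_perp:
  assumes "linear (X x)" "z \<in> ker_perp (X x)"
  shows "adjoint_map X x (X x z) = z"
  unfolding adjoint_map_def
proof (rule the_equality)
  show z: "\<forall>a. z \<bullet> a = induced_metric X x (X x z) (X x a)"
    by (simp add: induced_metric_commute[of X x "X x z"] induced_metric_ker_perp assms inner_commute)
  show "y = z" if "\<forall>a. y \<bullet> a = induced_metric X x (X x z) (X x a)" for y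
    using that z by (simp add: vector_eq_rdot[of y z, symmetric])
qed

lemma adjoint_map_range:
  assumes "linear (X x)" "t \<in> range (X x)"
  shows "X x (adjoint_map X x t) = t" "induced_metric X x (X x a) t = a \<bullet> adjoint_map X x t"
proof -
  obtain z where z: "z \<in> ker_perp (X x)" "t = X x z"
    using assms image_ker_perp by blast
  show "X x (adjoint_map X x t) = t" "induced_metric X x (X x a) t = a \<bullet> adjoint_map X x t"
    by (simp_all add: z adjoint_map_ker_perp induced_metric_ker_perp assms(1))
qed

section \<open>The LeJan-Watanabe connection in a chart\<close>

locale lw_chart =
  fixes T :: "'a topology"
    and A :: "('a, real ^ 'n) chart set"
    and X :: "'a \<Rightarrow> real ^ 'm \<Rightarrow> ('a, real ^ 'n) tvec"
    and c :: "('a, real ^ 'n) chart"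
  assumes manifold: "smooth_manifold T A"
    and X: "smooth_surjective_bundle_map T A X"
    and c: "c \<in> A"
begin

lemma chart: "is_chart T c"
  using manifold c by (rule smooth_manifold_charts)

lemma cdom_topspace: "x \<in> cdom c \<Longrightarrow> x \<in> topspace T"
  using chart openin_subset unfolding is_chart_def by blast

lemma linear_X: "x \<in> topspace T \<Longrightarrow> linear (X x)"
  and range_X: "x \<in> topspace T \<Longrightarrow> range (X x) = tangent_space A x"
  and smooth_X: "smooth_vector_field A (topspace T) (\<lambda>x. X x a)"
  using X by (auto simp: smooth_surjective_bundle_map_def)

lemma cinv_cmap [simp]: "x \<in> cdom c \<Longrightarrow> cinv c (cmap c x) = x"
  using chart by (simp add: chart_inj_on)

section \<open>Smoothness of the adjoint via the Gram matrix\<close>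

definition coord_matrix :: "real ^ 'n \<Rightarrow> real ^ 'm ^ 'n" where
  "coord_matrix p = matrix (\<lambda>a. tcoord (X (cinv c p) a) c)"

lemma coord_matrix:
  assumes "x \<in> cdom c"
  shows "coord_matrix (cmap c x) *v a = tcoord (X x a) c"
proof -
  have "linear (\<lambda>a. tcoord (X x a) c)"
    using linear_X[OF cdom_topspace[OF assms]] by (simp add: linear_iff)
  then show ?thesis
    using assms by (simp add: coord_matrix_def matrix_works)
qed

text \<open>On the chart image this is the inverse of the coordinate matrix of the induced metric;
  it is the matrix to be inverted in the chart formula for the adjoint.\<close>

definition gram :: "real ^ 'n \<Rightarrow> real ^ 'n ^ 'n" where
  "gram p = coord_matrix p ** transpose (coord_matrix p)"

text \<open>The quadratic form of \<open>gram\<close> at \<open>z\<close> is the squared length of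
  \<open>transpose B *v z\<close>, with \<open>B\<close> the coordinate matrix. Every
  \<open>z\<close> is the coordinate vector of some \<open>X x a\<close>, so
  \<open>transpose B\<close> is injective.\<close>

lemma gram_invertible:
  assumes "x \<in> cdom c"
  shows "invertible (gram (cmap c x))"
proof -
  let ?B = "coord_matrix (cmap c x)"
  have x: "x \<in> topspace T" "c \<in> charts_at A x"
    using assms c cdom_topspace by (auto simp: charts_at_def)
  have "z = 0" if "gram (cmap c x) *v z = 0" for z
  proof -
    have "(transpose ?B *v z) \<bullet> (transpose ?B *v z) = z \<bullet> (gram (cmap c x) *v z)"
      by (simp only: gram_def inner_transpose_matrix matrix_vector_mul_assoc)
    then have z: "transpose ?B *v z = 0"
      using that by simp
    obtain t where t: "t \<in> tangent_space A x" "tcoord t c = z"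
      by (rule tangent_exists[OF manifold x(2)])
    then obtain a where "t = X x a"
      using range_X[OF x(1)] by blast
    then have "z \<bullet> z = z \<bullet> (?B *v a)"
      using t coord_matrix[OF assms] by simp
    also have "\<dots> = (transpose ?B *v z) \<bullet> a"
      by (rule inner_transpose_matrix[symmetric])
    finally show "z = 0"
      using z by simp
  qed
  then show ?thesis
    using matrix_left_invertible_ker invertible_left_inverse by blast
qed

lemma gram_inverse:
  assumes "x \<in> cdom c"
  shows "gram (cmap c x) *v (matrix_inv (gram (cmap c x)) *v b) = b"
proof -
  have "gram (cmap c x) ** matrix_inv (gram (cmap c x)) = mat 1"
    using gram_invertible[OF assms] unfolding invertible_def matrix_inv_def by (rule someI2_ex) simp
  then show ?thesis
    by (simp add: matrix_vector_mul_assoc)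
qed

text \<open>With \<open>B\<close> the coordinate matrix, \<open>transpose B *v z\<close> is
  orthogonal to the kernel of \<open>X x\<close>, and \<open>X x\<close> sends it to
  \<open>t\<close> because \<open>gram\<close> is \<open>B ** transpose B\<close>. On such vectors
  \<open>adjoint_map\<close> inverts \<open>X x\<close>.\<close>

lemma adjoint_map_coord:
  assumes x: "x \<in> cdom c" and t: "t \<in> tangent_space A x"
    and z: "gram (cmap c x) *v z = tcoord t c"
  shows "adjoint_map X x t = transpose (coord_matrix (cmap c x)) *v z"
proof -
  let ?B = "coord_matrix (cmap c x)"
  let ?y = "transpose ?B *v z"
  note lin = linear_X[OF cdom_topspace[OF x]]
  have "?y \<bullet> k = 0" if "X x k = 0" for k
  proof -
    have "?y \<bullet> k = z \<bullet> (?B *v k)"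
      by (rule inner_transpose_matrix)
    then show ?thesis
      using that coord_matrix[OF x, of k] by simp
  qed
  then have ker: "?y \<in> ker_perp (X x)"
    by (simp add: ker_perp_def orthogonal_comp_def orthogonal_def inner_commute)
  have "X x ?y = t"
  proof (rule tangent_eqI)
    show "X x ?y \<in> tangent_space A x"
      using range_X[OF cdom_topspace[OF x]] by blast
    show "c \<in> charts_at A x"
      using x c by (simp add: charts_at_def)
    show "tcoord (X x ?y) c = tcoord t c"
      using z by (simp only: coord_matrix[OF x, symmetric] gram_def matrix_vector_mul_assoc)
  qed (rule t)
  then show ?thesis
    using adjoint_map_ker_perp[of X x ?y, OF lin ker] by simp
qed

text \<open>The chart formula for the adjoint combines the smooth coordinate matrix with the
  solution of a linear system whose matrix is \<open>gram\<close>, and Cramer's rule keeps that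
  solution smooth.\<close>

lemma Ck_on_adjoint_map:
  assumes N: "openin T N" and W: "smooth_vector_field A N W"
  shows "Ck_on k (cmap c ` (N \<inter> cdom c)) (\<lambda>p. adjoint_map X (cinv c p) (W (cinv c p)))"
proof (rule Ck_on_cong)
  let ?S = "cmap c ` (N \<inter> cdom c)"
  show op: "open ?S"
    using chart N by (rule chart_open_image)
  have "openin T (cdom c)" "openin T (N \<inter> cdom c)"
    using chart N by (auto simp: is_chart_def)
  then have S: "?S \<subseteq> cmap c ` (topspace T \<inter> cdom c)"
    using openin_subset by fastforce
  have sub: "Ck_on k S' f \<Longrightarrow> S \<subseteq> S' \<Longrightarrow> Ck_on k S f" for S S' and f :: "real ^ 'n \<Rightarrow> real ^ 'n"
    by (induction k arbitrary: f) (auto intro: continuous_on_subset)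
  have "Ck_on k ?S (\<lambda>p. tcoord (X (cinv c p) a) c)" for a
    using smooth_X[of a] c by (intro sub[OF _ S]) (simp add: smooth_vector_field_def smooth_on_def)
  then have M: "Ck_on k ?S coord_matrix"
    unfolding coord_matrix_def[abs_def] matrix_def
    by (intro Ck_on_vec_lambda Ck_on_vec_nth op)
  have gram: "Ck_on k ?S gram"
    unfolding gram_def[abs_def]
    by (intro Ck_on_bilinear[OF op bounded_bilinear_matrix_matrix_mult]
        Ck_on_bounded_linear[OF op bounded_linear_transpose] M)
  have "Ck_on k ?S (\<lambda>p. tcoord (W (cinv c p)) c)"
    using W c by (simp add: smooth_vector_field_def smooth_on_def)
  then have "Ck_on k ?S (\<lambda>p. matrix_inv (gram p) *v tcoord (W (cinv c p)) c)"
    by (rule Ck_on_linear_solve[OF op gram])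
       (auto simp: gram_invertible gram_inverse)
  then show "Ck_on k ?S (\<lambda>p. transpose (coord_matrix p) *v (matrix_inv (gram p) *v tcoord (W (cinv c p)) c))"
    by (rule Ck_on_bilinear[OF op bounded_bilinear_matrix_vector_mult
          Ck_on_bounded_linear[OF op bounded_linear_transpose M]])
  show "transpose (coord_matrix p) *v (matrix_inv (gram p) *v tcoord (W (cinv c p)) c) =
      adjoint_map X (cinv c p) (W (cinv c p))" if "p \<in> ?S" for p
  proof -
    obtain x where x: "x \<in> N" "x \<in> cdom c" "p = cmap c x"
      using \<open>p \<in> ?S\<close> by blast
    have "W x \<in> tangent_space A x"
      using W x by (simp add: smooth_vector_field_def)
    from adjoint_map_coord[OF x(2) this gram_inverse[OF x(2)]] show ?thesis
      using x by simp
  qed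
qed

section \<open>The projection field of \<open>X\<close>\<close>

definition proj :: "real ^ 'n \<Rightarrow> real ^ 'm ^ 'm" where
  "proj p = matrix (\<lambda>a. adjoint_map X (cinv c p) (X (cinv c p) a))"

text \<open>Both sides equal the induced metric of \<open>X x a\<close> and \<open>X x b\<close>,
  which is symmetric.\<close>

lemma adjoint_map_sym:
  assumes "x \<in> cdom c"
  shows "adjoint_map X x (X x a) \<bullet> b = a \<bullet> adjoint_map X x (X x b)"
proof -
  have *: "induced_metric X x (X x a) (X x b) = a \<bullet> adjoint_map X x (X x b)" for a b
    by (intro adjoint_map_range linear_X cdom_topspace assms rangeI)
  show ?thesis
    using *[of a b] *[of b a] by (simp add: induced_metric_commute[of X x "X x a"] inner_commute)
qed

lemma proj:
  assumes "x \<in> cdom c"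
  shows "proj (cmap c x) *v a = adjoint_map X x (X x a)"
proof -
  have "linear (\<lambda>a. adjoint_map X x (X x a))"
    \<comment> \<open>\<open>adjoint_map\<close> is given by a description, so linearity is read off
      from symmetry: the inner product with any fixed vector is linear in \<open>a\<close>.\<close>
    by (rule linearI; rule vector_eq_rdot[THEN iffD1]) (simp_all add: adjoint_map_sym[OF assms] inner_add_left)
  then show ?thesis
    using assms by (simp add: proj_def matrix_works)
qed

lemma X_adjoint_map: "x \<in> cdom c \<Longrightarrow> t \<in> tangent_space A x \<Longrightarrow> X x (adjoint_map X x t) = t"
  using adjoint_map_range(1)[of X x t] linear_X range_X cdom_topspace by blast

lemma X_tangent: "x \<in> cdom c \<Longrightarrow> X x a \<in> tangent_space A x"
  using range_X cdom_topspace by blast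

lemma X_proj: "x \<in> cdom c \<Longrightarrow> X x (proj (cmap c x) *v a) = X x a"
  by (simp add: proj X_adjoint_map X_tangent)

lemma proj_adjoint_map:
  assumes "x \<in> cdom c" "t \<in> tangent_space A x"
  shows "proj (cmap c x) *v adjoint_map X x t = adjoint_map X x t"
  using assms by (simp add: proj X_adjoint_map)

lemma proj_idem: "p \<in> cmap c ` cdom c \<Longrightarrow> proj p ** proj p = proj p"
  by (auto simp: matrix_eq matrix_vector_mul_assoc[symmetric] proj X_adjoint_map X_tangent)

lemma proj_sym:
  assumes "p \<in> cmap c ` cdom c"
  shows "transpose (proj p) = proj p"
proof -
  obtain x where x: "x \<in> cdom c" "p = cmap c x" using assms by blast
  have "(transpose (proj p) *v b) \<bullet> a = (proj p *v b) \<bullet> a" for a b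
    unfolding inner_transpose_matrix using adjoint_map_sym[OF x(1), of b a] by (simp add: x proj)
  then have "transpose (proj p) *v b = proj p *v b" for b
    by (rule vector_eq_rdot[THEN iffD1, rule_format])
  then show ?thesis
    by (rule matrix_eq[THEN iffD2, rule_format])
qed

lemma Ck_on_proj: "Ck_on k (cmap c ` cdom c) proj"
proof -
  have "topspace T \<inter> cdom c = cdom c"
    using cdom_topspace by blast
  then have "Ck_on k (cmap c ` cdom c) (\<lambda>p. adjoint_map X (cinv c p) (X (cinv c p) a))" for a
    using Ck_on_adjoint_map[OF openin_topspace smooth_X, of k a] by simp
  then show ?thesis
    unfolding proj_def[abs_def] matrix_def
    using chart by (intro Ck_on_vec_lambda Ck_on_vec_nth) (auto simp: is_chart_def)
qed

section \<open>Covariant derivatives in terms of the projection\<close>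

abbreviation proj' :: "'a \<Rightarrow> ('a, real ^ 'n) tvec \<Rightarrow> real ^ 'm ^ 'm" where
  "proj' x t \<equiv> frechet_derivative proj (at (cmap c x)) (tcoord t c)"

lemma has_derivative_proj:
  assumes "x \<in> cdom c"
  shows "(proj has_derivative frechet_derivative proj (at (cmap c x))) (at (cmap c x))"
  using Ck_on_proj by (rule Ck_on_has_derivative) (use assms in simp)

lemma lw_nabla_X:
  assumes x: "x \<in> cdom c" and t: "t \<in> tangent_space A x"
  shows "lw_nabla A X t (\<lambda>y. X y a) x = X x (proj' x t *v a)"
proof -
  have op: "open (cmap c ` cdom c)"
    using chart by (simp add: is_chart_def)
  have "((\<lambda>p. proj p *v a) has_derivative (\<lambda>h. frechet_derivative proj (at (cmap c x)) h *v a)) (at (cmap c x))"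
    using bounded_bilinear.FDERIV[OF bounded_bilinear_matrix_vector_mult has_derivative_proj[OF x]
        has_derivative_const[of a]] by simp
  then have "((\<lambda>y. adjoint_map X y (X y a)) \<circ> cinv c has_derivative
      (\<lambda>h. frechet_derivative proj (at (cmap c x)) h *v a)) (at (cmap c x))"
    by (rule has_derivative_transform_within_open[OF _ op]) (use x in \<open>auto simp: proj\<close>)
  from differential_chart[OF manifold _ this t] show ?thesis
    using x c by (simp add: lw_nabla_def charts_at_def)
qed

lemma lw_nabla_chart:
  assumes x: "x \<in> cdom c" "x \<in> N" and t: "t \<in> tangent_space A x"
    and N: "openin T N" and W: "smooth_vector_field A N W"
  shows "lw_nabla A X t W x =
    X x (frechet_derivative (\<lambda>p. adjoint_map X (cinv c p) (W (cinv c p))) (at (cmap c x)) (tcoord t c))"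
proof -
  let ?f = "\<lambda>p. adjoint_map X (cinv c p) (W (cinv c p))"
  have "(?f has_derivative frechet_derivative ?f (at (cmap c x))) (at (cmap c x))"
    using Ck_on_adjoint_map[OF N W] by (rule Ck_on_has_derivative) (use x in simp)
  then have "((\<lambda>y. adjoint_map X y (W y)) \<circ> cinv c has_derivative frechet_derivative ?f (at (cmap c x))) (at (cmap c x))"
    by (simp add: comp_def)
  from differential_chart[OF manifold _ this t] show ?thesis
    using x c by (simp add: lw_nabla_def charts_at_def)
qed

text \<open>The lift of the inner covariant derivative is \<open>proj\<close> applied to the
  derivative of \<open>f\<close> along \<open>V\<close>. The three summands differentiate
  \<open>proj\<close>, the derivative of \<open>f\<close>, and \<open>V\<close>; the outer
  \<open>X x\<close> absorbs the factor \<open>proj\<close> in the last two.\<close>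

lemma lw_nabla_lw_nabla:
  assumes x: "x \<in> cdom c" "x \<in> N" and t: "t \<in> tangent_space A x"
    and N: "openin T N" and V: "smooth_vector_field A N V" and W: "smooth_vector_field A N W"
  defines "f \<equiv> \<lambda>p. adjoint_map X (cinv c p) (W (cinv c p))"
    and "V' \<equiv> frechet_derivative (\<lambda>p. tcoord (V (cinv c p)) c) (at (cmap c x))"
  shows "lw_nabla A X t (\<lambda>y. lw_nabla A X (V y) W y) x =
    X x (proj' x t *v frechet_derivative f (at (cmap c x)) (tcoord (V x) c)
      + frechet_derivative (\<lambda>q. frechet_derivative f (at q) (tcoord (V x) c)) (at (cmap c x)) (tcoord t c)
      + frechet_derivative f (at (cmap c x)) (V' (tcoord t c)))"
proof -
  let ?S = "cmap c ` (N \<inter> cdom c)" and ?p = "cmap c x"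
  let ?v = "\<lambda>p. tcoord (V (cinv c p)) c"
  let ?D = "\<lambda>q. frechet_derivative f (at q)"
  let ?E = "frechet_derivative (\<lambda>q. ?D q (tcoord (V x) c)) (at ?p)"
  have op: "open ?S"
    using chart N by (rule chart_open_image)
  have p: "?p \<in> ?S" using x by simp
  have "Ck_on (Suc 0) ?S ?v"
    using V c unfolding smooth_vector_field_def smooth_on_def by blast
  then have dV: "(?v has_derivative V') (at ?p)"
    unfolding V'_def using p by (rule Ck_on_has_derivative)
  have f: "Ck_on 2 ?S f"
    unfolding f_def by (rule Ck_on_adjoint_map[OF N W])
  have "((\<lambda>q. ?D q (?v q)) has_derivative (\<lambda>h. ?E h + ?D ?p (V' h))) (at ?p)"
    using has_derivative_directional[OF op f p dV] x by (simp only: cinv_cmap)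
  from bounded_bilinear.FDERIV[OF bounded_bilinear_matrix_vector_mult has_derivative_proj[OF x(1)] this]
  have "((\<lambda>q. proj q *v ?D q (?v q)) has_derivative
      (\<lambda>h. proj ?p *v (?E h + ?D ?p (V' h)) + frechet_derivative proj (at ?p) h *v ?D ?p (tcoord (V x) c))) (at ?p)"
    using x by simp
  then have d: "((\<lambda>y. adjoint_map X y (lw_nabla A X (V y) W y)) \<circ> cinv c has_derivative
      (\<lambda>h. proj ?p *v (?E h + ?D ?p (V' h)) + frechet_derivative proj (at ?p) h *v ?D ?p (tcoord (V x) c))) (at ?p)"
  proof (rule has_derivative_transform_within_open[OF _ op p])
    fix q assume "q \<in> ?S"
    then obtain y where y: "y \<in> cdom c" "y \<in> N" "q = cmap c y" by blast
    then have "V y \<in> tangent_space A y"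
      using V by (simp add: smooth_vector_field_def)
    from lw_nabla_chart[OF y(1,2) this N W]
    show "proj q *v ?D q (?v q) = ((\<lambda>y. adjoint_map X y (lw_nabla A X (V y) W y)) \<circ> cinv c) q"
      using y by (simp add: proj f_def)
  qed
  have "c \<in> charts_at A x"
    using x c by (simp add: charts_at_def)
  from differential_chart[OF manifold this d t]
  show ?thesis
    using X_proj[OF x(1)] linear_X[OF cdom_topspace[OF x(1)]]
    by (simp add: lw_nabla_def[of A X t "\<lambda>y. lw_nabla A X (V y) W y"] linear_add algebra_simps)
qed

section \<open>The curvature in terms of the projection\<close>

lemma lw_curvature_fields_proj:
  assumes some: "c = (SOME c. c \<in> charts_at A x)"
    and x: "x \<in> cdom c" "x \<in> N" and N: "openin T N" and U: "smooth_vector_field A N U"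
    and V: "smooth_vector_field A N V" and W: "smooth_vector_field A N W"
  shows "lw_curvature_fields A X U V W x =
    X x (proj' x (U x) *v (proj' x (V x) *v adjoint_map X x (W x)))
      - X x (proj' x (V x) *v (proj' x (U x) *v adjoint_map X x (W x)))"
proof -
  let ?S = "cmap c ` (N \<inter> cdom c)" and ?p = "cmap c x"
  define f where "f = (\<lambda>p. adjoint_map X (cinv c p) (W (cinv c p)))"
  let ?D = "\<lambda>q. frechet_derivative f (at q)"
  let ?E = "\<lambda>k. frechet_derivative (\<lambda>q. ?D q k) (at ?p)"
  let ?d = "\<lambda>Z. frechet_derivative (\<lambda>p. tcoord (Z (cinv c p)) c) (at ?p)"
  let ?u = "tcoord (U x) c" and ?v = "tcoord (V x) c"
  have op: "open ?S"
    using chart N by (rule chart_open_image)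
  have p: "?p \<in> ?S" using x by simp
  have tangent: "U x \<in> tangent_space A x" "V x \<in> tangent_space A x"
    using U V x by (simp_all add: smooth_vector_field_def)
  note lin = linear_X[OF cdom_topspace[OF x(1)]]
  have f: "Ck_on 2 ?S f"
    unfolding f_def by (rule Ck_on_adjoint_map[OF N W])
  then have df: "(f has_derivative ?D ?p) (at ?p)"
    unfolding numeral_2_eq_2 using p by (rule Ck_on_has_derivative)
  have fixed: "proj q *v f q = f q" if "q \<in> ?S" for q
  proof -
    obtain y where y: "y \<in> N" "y \<in> cdom c" "q = cmap c y"
      using \<open>q \<in> ?S\<close> by blast
    then have "W y \<in> tangent_space A y"
      using W by (simp add: smooth_vector_field_def)
    then show ?thesis
      using y by (simp add: f_def proj_adjoint_map)
  qed
  \<comment> \<open>Since \<open>X x\<close> absorbs the leading \<open>proj\<close>, the commutator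
    identity replaces the derivative of \<open>f\<close> along \<open>k\<close> by a term in the
    value of \<open>f\<close>.\<close>
  have comm: "X x (frechet_derivative proj (at ?p) h *v ?D ?p k) =
      X x (frechet_derivative proj (at ?p) h *v (frechet_derivative proj (at ?p) k *v adjoint_map X x (W x)))"
    for h k
  proof -
    have fp: "f ?p = adjoint_map X x (W x)"
      using x by (simp add: f_def)
    have idem: "proj q ** proj q = proj q" if "q \<in> ?S" for q
      using that by (intro proj_idem) blast
    note derivative_projection_commutator[OF op p has_derivative_proj[OF x(1)] idem df fixed, of h k, unfolded fp]
    from arg_cong[OF this, of "X x"] show ?thesis
      by (simp only: X_proj[OF x(1)])
  qed
  have "c \<in> charts_at A x" using x c by (simp add: charts_at_def)
  \<comment> \<open>Chart independence of \<open>differential\<close> was shown for tangent vectors,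
    and the bracket is not shown to be one; hence \<open>differential\<close> is unfolded in the
    chart that it selects, which is \<open>c\<close> by \<open>some\<close>.\<close>
  then have bracket: "lw_nabla A X (lie_bracket A U V x) W x = X x (?D ?p (?d V ?u - ?d U ?v))"
    using x by (simp add: lw_nabla_def differential_def some[symmetric] lie_bracket_def Tvec_inverse f_def comp_def)
  \<comment> \<open>The second derivatives of \<open>f\<close> cancel by symmetry, and the
    derivatives of \<open>V\<close> and \<open>U\<close> cancel against the bracket; only the terms
    with a derivative of \<open>proj\<close> survive.\<close>
  have "?E ?u ?v = ?E ?v ?u"
    by (rule second_derivative_symmetric[OF op f p])
  moreover have "?D ?p (?d V ?u - ?d U ?v) = ?D ?p (?d V ?u) - ?D ?p (?d U ?v)"
    by (rule linear_diff[OF has_derivative_linear[OF df]])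
  ultimately show ?thesis
    unfolding lw_curvature_fields_def bracket
      lw_nabla_lw_nabla[OF x tangent(1) N V W, folded f_def]
      lw_nabla_lw_nabla[OF x tangent(2) N U W, folded f_def]
    by (simp add: linear_add[OF lin] linear_diff[OF lin] comm)
qed

text \<open>The formula for fields involves only their values at \<open>x\<close>, so it is common
  to all extensions of \<open>u\<close>, \<open>v\<close>, \<open>w\<close>. For it to be the only
  such value, some extension must exist.\<close>

lemma lw_curvature_proj:
  assumes some: "c = (SOME c. c \<in> charts_at A x)" and x: "x \<in> cdom c"
    and u: "u \<in> tangent_space A x" and v: "v \<in> tangent_space A x" and w: "w \<in> tangent_space A x"
  shows "lw_curvature T A X x u v w =
    X x (proj' x u *v (proj' x v *v adjoint_map X x w)) - X x (proj' x v *v (proj' x u *v adjoint_map X x w))"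
  unfolding lw_curvature_def
proof (rule the_equality)
  show "\<forall>N U V W. openin T N \<and> x \<in> N \<and>
      smooth_vector_field A N U \<and> smooth_vector_field A N V \<and> smooth_vector_field A N W \<and>
      U x = u \<and> V x = v \<and> W x = w \<longrightarrow>
      lw_curvature_fields A X U V W x =
        X x (proj' x u *v (proj' x v *v adjoint_map X x w)) - X x (proj' x v *v (proj' x u *v adjoint_map X x w))"
    using lw_curvature_fields_proj[OF some x] by blast
  then have *: "lw_curvature_fields A X U V W x =
        X x (proj' x u *v (proj' x v *v adjoint_map X x w)) - X x (proj' x v *v (proj' x u *v adjoint_map X x w))"
    if "openin T N" "x \<in> N" "smooth_vector_field A N U" "smooth_vector_field A N V" "smooth_vector_field A N W"
      "U x = u" "V x = v" "W x = w" for N U V W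
    using that by blast
  fix r
  assume r: "\<forall>N U V W. openin T N \<and> x \<in> N \<and>
      smooth_vector_field A N U \<and> smooth_vector_field A N V \<and> smooth_vector_field A N W \<and>
      U x = u \<and> V x = v \<and> W x = w \<longrightarrow> lw_curvature_fields A X U V W x = r"
  note top = cdom_topspace[OF x]
  \<comment> \<open>Surjectivity of \<open>X x\<close> writes each vector as \<open>X x a\<close>,
    and the field \<open>X a\<close> is a smooth extension to the whole manifold.\<close>
  obtain a b d where "u = X x a" "v = X x b" "w = X x d"
    using u v w range_X[OF top] by blast
  then show "r = X x (proj' x u *v (proj' x v *v adjoint_map X x w)) - X x (proj' x v *v (proj' x u *v adjoint_map X x w))"
    using r[rule_format, of "topspace T" "\<lambda>x. X x a" "\<lambda>x. X x b" "\<lambda>x. X x d"]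
      *[of "topspace T" "\<lambda>x. X x a" "\<lambda>x. X x b" "\<lambda>x. X x d"] top smooth_X by simp
qed

text \<open>The metric becomes an inner product with the lift of \<open>w\<close>; the symmetric
  matrix \<open>proj' x t\<close> moves to that side, and expanding a vector in the orthonormal
  basis collapses the sum.\<close>

lemma sum_lw_nabla_X:
  fixes e :: "'m \<Rightarrow> real ^ 'm"
  assumes orthonormal: "\<And>i j. e i \<bullet> e j = (if i = j then 1 else 0)"
    and basis: "span (range e) = UNIV"
    and x: "x \<in> cdom c" and s: "s \<in> tangent_space A x" and t: "t \<in> tangent_space A x"
    and w: "w \<in> tangent_space A x"
  shows "(\<Sum>i\<in>UNIV. induced_metric X x (lw_nabla A X t (\<lambda>x. X x (e i)) x) w *\<^sub>R
      lw_nabla A X s (\<lambda>x. X x (e i)) x) = X x (proj' x s *v (proj' x t *v adjoint_map X x w))"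
proof -
  let ?b = "proj' x t *v adjoint_map X x w"
  note lin = linear_X[OF cdom_topspace[OF x]]
  have op: "open (cmap c ` cdom c)"
    using chart by (simp add: is_chart_def)
  have sym: "transpose (proj' x t) = proj' x t"
    using x by (intro derivative_transpose[OF op _ has_derivative_proj[OF x]]) (auto simp: proj_sym)
  have "induced_metric X x (lw_nabla A X t (\<lambda>x. X x (e i)) x) w = e i \<bullet> ?b" for i
  proof -
    have "induced_metric X x (lw_nabla A X t (\<lambda>x. X x (e i)) x) w = (proj' x t *v e i) \<bullet> adjoint_map X x w"
      using w range_X[OF cdom_topspace[OF x]]
      by (simp add: lw_nabla_X[OF x t] adjoint_map_range(2)[of X x, OF lin])
    also have "\<dots> = e i \<bullet> ?b"
      using inner_transpose_matrix[of "proj' x t" "e i" "adjoint_map X x w"] by (simp only: sym)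
    finally show ?thesis .
  qed
  then have "(\<Sum>i\<in>UNIV. induced_metric X x (lw_nabla A X t (\<lambda>x. X x (e i)) x) w *\<^sub>R
      lw_nabla A X s (\<lambda>x. X x (e i)) x) = (\<Sum>i\<in>UNIV. (e i \<bullet> ?b) *\<^sub>R X x (proj' x s *v e i))"
    by (simp add: lw_nabla_X[OF x s])
  also have "\<dots> = X x (proj' x s *v (\<Sum>i\<in>UNIV. (e i \<bullet> ?b) *\<^sub>R e i))"
    by (simp add: linear_sum[OF lin] linear_scale[OF lin] linear_sum[OF matrix_vector_mul_linear] matrix_vector_mult_scaleR)
  also have "(\<Sum>i\<in>UNIV. (e i \<bullet> ?b) *\<^sub>R e i) = ?b"
  proof -
    \<comment> \<open>The basis expansion is a sum over a set of vectors; injectivity of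
      \<open>e\<close>, forced by orthonormality, converts it into a sum over indices.\<close>
    have inj: "inj e"
      by (rule injI) (metis orthonormal zero_neq_one)
    have "(\<Sum>k\<in>range e. (?b \<bullet> k) *\<^sub>R k) = ?b"
      using inj basis
      by (intro orthonormal_basis_expand) (auto simp: pairwise_def orthogonal_def orthonormal norm_eq_1)
    then show ?thesis
      by (simp add: sum.reindex[OF inj] inner_commute)
  qed
  finally show ?thesis .
qed

end

theorem propositionA1:
  fixes T :: "'a topology"
    and A :: "('a, real ^ 'n) chart set"
    and X :: "'a \<Rightarrow> real ^ 'm \<Rightarrow> ('a, real ^ 'n) tvec"
    and e :: "'m \<Rightarrow> real ^ 'm"
    and x0 :: 'a
    and u v w :: "('a, real ^ 'n) tvec"
  assumes manifold: "smooth_manifold T A"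
    and X: "smooth_surjective_bundle_map T A X"
    and orthonormal: "\<And>i j. e i \<bullet> e j = (if i = j then 1 else 0)"
    and basis: "span (range e) = UNIV"
    and x0: "x0 \<in> topspace T"
    and u: "u \<in> tangent_space A x0"
    and v: "v \<in> tangent_space A x0"
    and w: "w \<in> tangent_space A x0"
  shows "lw_curvature T A X x0 u v w =
      (\<Sum>i\<in>UNIV. induced_metric X x0 (lw_nabla A X v (\<lambda>x. X x (e i)) x0) w *\<^sub>R
                  lw_nabla A X u (\<lambda>x. X x (e i)) x0)
    - (\<Sum>i\<in>UNIV. induced_metric X x0 (lw_nabla A X u (\<lambda>x. X x (e i)) x0) w *\<^sub>R
                  lw_nabla A X v (\<lambda>x. X x (e i)) x0)"
proof -
  \<comment> \<open>This is the chart that \<open>differential\<close> selects at \<open>x0\<close>,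
    as the treatment of the bracket term requires.\<close>
  define c where "c = (SOME c. c \<in> charts_at A x0)"
  have "x0 \<in> (\<Union>c\<in>A. cdom c)"
    using manifold x0 by (simp only: smooth_manifold_def)
  then obtain d where "d \<in> charts_at A x0"
    unfolding charts_at_def by blast
  then have "c \<in> charts_at A x0"
    unfolding c_def by (rule someI)
  then have c: "c \<in> A" and x: "x0 \<in> cdom c"
    by (auto simp: charts_at_def)
  interpret lw_chart T A X c
    using manifold X c by unfold_locales
  show ?thesis
    unfolding sum_lw_nabla_X[OF orthonormal basis x u v w] sum_lw_nabla_X[OF orthonormal basis x v u w]
    by (rule lw_curvature_proj[OF c_def x u v w])
qed

end
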